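(* Let $n \in \mathbb{N}$, let $\lambda,\mu \in \mathbb{Z}^n$, and let $\mathbf{x} \in X_n$ be a GT-pattern lying in the Gelfand--Tsetlin polytope $GT(\lambda,\mu)$. Let $\mathscr{P}$ be the tiling of $\mathbf{x}$, with $s$ free tiles, and let $A_{\mathscr{P}}$ be its tiling matrix, regarded as a linear map on $\mathbb{R}^s$. Then the dimension of the kernel of $A_{\mathscr{P}}$ is equal to the dimension of the minimal (lowest-dimensional) face of $GT(\lambda,\mu)$ containing $\mathbf{x}$.
   Context: For $n\in\mathbb{N}$, $X_n$ is the real vector space of all triangular arrays $(x_{ij})_{1\le i\le j\le n}$ with $x_{ij}\in\mathbb{R}$, so $X_n \cong \mathbb{R}^{n(n+1)/2}$. For fixed $j$, the entries $x_{1j},\dots,x_{jj}$ form the $j$th row; the $n$th row is the top row and $x_{11}$ is the bottom row. A Gelfand--Tsetlin pattern (GT-pattern) is an array $(x_{ij})_{1\le i\le j\le n}\in X_n$ with $x_{ij}\ge 0$ for $1\le i\le j\le n$ and $x_{i,j+1}\ge x_{ij}\ge x_{i+1,j+1}$ for $1\le i\le j\le n-1$. For $\lambda,\mu\in\mathbb{Z}^n$, the Gelfand--Tsetlin polytope (GT-polytope) $GT(\lambda,\mu)\subset X_n$ is the convex polytope of all GT-patterns $(x_{ij})$ with $x_{in}=\lambda_i$ for $1\le i\le n$, $x_{11}=\mu_1$, and $\sum_{i=1}^{j}x_{ij}-\sum_{i=1}^{j-1}x_{i,j-1}=\mu_j$ for $2\le j\le n$. The tiling $\mathscr{P}$ of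 a GT-pattern $\mathbf{x}\in X_n$ is the partition of $\{(i,j)\in\mathbb{Z}^2: 1\le i\le j\le n\}$ into subsets, called tiles, obtained by grouping together entries that are equal and adjacent: two pairs $(i,j),(\tilde i,\tilde j)$ in this index set are in the same tile iff there is a sequence of pairs $(i,j)=(i_1,j_1),(i_2,j_2),\dots,(i_r,j_r)=(\tilde i,\tilde j)$ in the index set such that, for each $k\in\{1,\dots,r-1\}$, $x_{i_{k+1}j_{k+1}}=x_{i_kj_k}$ and $(i_{k+1},j_{k+1})\in\{(i_k+1,j_k+1),(i_k,j_k+1),(i_k-1,j_k-1),(i_k,j_k-1)\}$. The free tiles $P_1,\dots,P_s$ of $\mathscr{P}$ are the tiles that do not contain $(1,1)$ and do not contain $(i,n)$ for any $1\le i\le n$ (the order of indexing is immaterial). The tiling matrix $A_{\mathscr{P}}=(a_{jk})_{2\le j\le n-1,\,1\le k\le s}$ is defined by $a_{jk}=\#\{i:(i,j)\in P_k\}$. *)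

theory Defs
  imports "HOL-Analysis.Analysis" "Jordan_Normal_Form.Matrix_Kernel"
begin

(* HOL-Analysis and Jordan_Normal_Form both use the infix notations "$" and "\<bullet>". *)
no_notation Matrix.vec_index (infixl "$" 100)
no_notation Matrix.scalar_prod (infix "\<bullet>" 70)

text \<open>
  The number \<open>n\<close> is the cardinality of a finite type \<open>'n\<close>, so that the space \<open>X\<^sub>n\<close> of
  triangular arrays is the Euclidean space \<open>real ^ 'n tri\<close> of dimension \<open>n (n + 1) / 2\<close>.
\<close>

definition tri_index :: "nat \<Rightarrow> (nat \<times> nat) set" where
  "tri_index n = {(i, j). 1 \<le> i \<and> i \<le> j \<and> j \<le> n}"

lemma finite_tri_index: "finite (tri_index n)"
  by (rule finite_subset[of _ "{..n} \<times> {..n}"]) (auto simp: tri_index_def)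

typedef ('n::finite) tri = "tri_index CARD('n)"
  morphisms tri_pair Tri
  by (rule exI[of _ "(1, 1)"]) (simp add: tri_index_def Suc_le_eq)

instance tri :: (finite) finite
proof
  show "finite (UNIV :: 'a tri set)"
    by (metis finite_tri_index finite_imageI type_definition.Abs_image type_definition_tri)
qed

text \<open>Only meaningful for \<open>(i, j) \<in> tri_index CARD('n)\<close>.\<close>
definition entry :: "real ^ ('n::finite) tri \<Rightarrow> nat \<Rightarrow> nat \<Rightarrow> real" where
  "entry x i j = x $ Tri (i, j)"

definition gt_pattern :: "real ^ ('n::finite) tri \<Rightarrow> bool" where
  "gt_pattern x \<longleftrightarrow>
     (\<forall>i j. 1 \<le> i \<and> i \<le> j \<and> j \<le> CARD('n) \<longrightarrow> entry x i j \<ge> 0) \<and>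
     (\<forall>i j. 1 \<le> i \<and> i \<le> j \<and> j + 1 \<le> CARD('n) \<longrightarrow>
        entry x i (j + 1) \<ge> entry x i j \<and> entry x i j \<ge> entry x (i + 1) (j + 1))"

text \<open>
  Elements of \<open>\<int>\<^sup>n\<close> are functions on \<open>nat\<close> of which only the values at \<open>1, \<dots>, n\<close> are used.
\<close>
definition gt_polytope :: "(nat \<Rightarrow> int) \<Rightarrow> (nat \<Rightarrow> int) \<Rightarrow> (real ^ ('n::finite) tri) set" where
  "gt_polytope lam mu = {x. gt_pattern x \<and>
     (\<forall>i\<in>{1..CARD('n)}. entry x i CARD('n) = of_int (lam i)) \<and>
     entry x 1 1 = of_int (mu 1) \<and>
     (\<forall>j\<in>{2..CARD('n)}.
        (\<Sum>i=1..j. entry x i j) - (\<Sum>i=1..j - 1. entry x i (j - 1)) = of_int (mu j))}"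

text \<open>
  Truncated subtraction is harmless in the next definition: it could only produce
  pairs with a component \<open>0\<close>, which are not in \<open>tri_index CARD('n)\<close>.
\<close>
definition tile_step :: "real ^ ('n::finite) tri \<Rightarrow> ((nat \<times> nat) \<times> (nat \<times> nat)) set" where
  "tile_step x = {((i, j), (i', j')).
     (i, j) \<in> tri_index CARD('n) \<and> (i', j') \<in> tri_index CARD('n) \<and>
     entry x i' j' = entry x i j \<and>
     (i', j') \<in> {(i + 1, j + 1), (i, j + 1), (i - 1, j - 1), (i, j - 1)}}"

definition tiling :: "real ^ ('n::finite) tri \<Rightarrow> (nat \<times> nat) set set" where
  "tiling x = tri_index CARD('n) // (tile_step x)\<^sup>*"

definition free_tiles :: "real ^ ('n::finite) tri \<Rightarrow> (nat \<times> nat) set set" where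
  "free_tiles x = {P \<in> tiling x. (1, 1) \<notin> P \<and> (\<forall>i\<in>{1..CARD('n)}. (i, CARD('n)) \<notin> P)}"

text \<open>
  The rows \<open>j = 2, \<dots>, n - 1\<close> and columns \<open>k = 1, \<dots>, s\<close> are numbered from \<open>0\<close> here;
  \<open>Ps\<close> is an enumeration of the free tiles. For \<open>n \<le> 2\<close> there are no rows.
\<close>
definition tiling_matrix :: "nat \<Rightarrow> (nat \<times> nat) set list \<Rightarrow> real mat" where
  "tiling_matrix n Ps =
     mat (n - 2) (length Ps) (\<lambda>(r, k). of_nat (card {i. (i, r + 2) \<in> Ps ! k}))"

definition minimal_face :: "'a::euclidean_space set \<Rightarrow> 'a \<Rightarrow> 'a set" where
  "minimal_face S x = (ARG_MIN aff_dim F. F face_of S \<and> x \<in> F)"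

text \<open>
  For convex \<open>S\<close>, in particular for \<open>gt_polytope lam mu\<close>, a face of least dimension exists, is
  unique, and is contained in every face through \<open>x\<close>.
\<close>

lemma convex_gt_polytope: "convex (gt_polytope lam mu :: (real ^ ('n::finite) tri) set)"
proof (rule convexI)
  fix x y :: "real ^ 'n tri" and u v :: real
  assume x: "x \<in> gt_polytope lam mu" and y: "y \<in> gt_polytope lam mu" and uv: "0 \<le> u" "0 \<le> v" "u + v = 1"
  have e: "entry (u *\<^sub>R x + v *\<^sub>R y) i j = u * entry x i j + v * entry y i j" for i j
    by (simp add: entry_def)
  have c: "u * c + v * c = c" for c :: real
    using uv(3) by (simp flip: distrib_right)
  have sums: "(u * a + v * b) - (u * a' + v * b') = c"
    if "a - a' = c" "b - b' = c" for a a' b b' c :: real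
  proof -
    have "(u * a + v * b) - (u * a' + v * b') = u * (a - a') + v * (b - b')"
      by (simp add: algebra_simps)
    then show ?thesis using that c by simp
  qed
  have "gt_pattern (u *\<^sub>R x + v *\<^sub>R y)"
    using x y uv unfolding gt_polytope_def gt_pattern_def e
    by (auto intro!: add_nonneg_nonneg mult_nonneg_nonneg add_mono mult_left_mono)
  then show "u *\<^sub>R x + v *\<^sub>R y \<in> gt_polytope lam mu"
    using x y unfolding gt_polytope_def
    by (simp add: e c sum.distrib sums flip: sum_distrib_left)
qed

lemma minimal_face_is_arg_min:
  fixes S :: "'a::euclidean_space set"
  assumes "convex S" "x \<in> S"
  shows "is_arg_min aff_dim (\<lambda>F. F face_of S \<and> x \<in> F) (minimal_face S x)"
proof -
  let ?P = "\<lambda>F. F face_of S \<and> x \<in> F"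
  have "?P S"
    using assms by (simp add: face_of_refl)
  then obtain F where F: "?P F" "\<And>G. ?P G \<Longrightarrow> nat (aff_dim F + 1) \<le> nat (aff_dim G + 1)"
    using ex_has_least_nat[of ?P S "\<lambda>F. nat (aff_dim F + 1)"] by blast
  have "is_arg_min aff_dim ?P F"
    unfolding is_arg_min_linorder
  proof (intro conjI allI impI)
    show "aff_dim F \<le> aff_dim G" if "?P G" for G
      using F(2)[OF that] aff_dim_geq[of F] aff_dim_geq[of G] by linarith
  qed (use F(1) in auto)
  then show ?thesis
    unfolding minimal_face_def arg_min_def by (rule someI)
qed

lemma minimal_face_least:
  fixes S :: "'a::euclidean_space set"
  assumes "convex S" "is_arg_min aff_dim (\<lambda>F. F face_of S \<and> x \<in> F) F" "G face_of S" "x \<in> G"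
  shows "F \<subseteq> G"
proof (rule ccontr)
  assume "\<not> F \<subseteq> G"
  have F: "F face_of S" "x \<in> F"
    and min: "\<And>H. H face_of S \<Longrightarrow> x \<in> H \<Longrightarrow> aff_dim F \<le> aff_dim H"
    using assms(2) by (auto simp: is_arg_min_linorder)
  have FG: "F \<inter> G face_of S"
    using F(1) assms(3) by (rule face_of_Int)
  then have "F \<inter> G face_of F"
    using face_of_subset[OF FG] face_of_imp_subset[OF F(1)] by blast
  moreover have "F \<inter> G \<noteq> F" using \<open>\<not> F \<subseteq> G\<close> by blast
  ultimately have "aff_dim (F \<inter> G) < aff_dim F"
    using face_of_aff_dim_lt face_of_imp_convex[OF F(1)] by blast
  then show False
    using min[OF FG] F(2) assms(4) by simp
qed

end

theory Submission
  imports Defs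
begin

text \<open>
  Let \<open>W\<close> be the space of arrays that are constant on every tile, vanish on the tiles that are not
  free, and have all row sums zero. Reading a vector indexed by the free tiles as an array identifies
  the kernel of the tiling matrix with \<open>W\<close>. On the other side, requiring equality along the
  adjacencies inside the tiles of \<open>x\<close> makes inequalities of the polytope tight, so it cuts out a face,
  and the minimal face lies in \<open>x + W\<close>. Conversely, \<open>x \<plusminus> \<epsilon> w\<close> lies in the polytope for every
  \<open>w \<in> W\<close> and small \<open>\<epsilon>\<close>, hence in every face through \<open>x\<close>; so the minimal face spans \<open>x + W\<close>.
\<close>

section \<open>Kernel dimension under an injective linear map\<close>

text \<open>Bridge between two notions of dimension: carrier-based vectors for the kernel,
  type-class vectors for the arrays. Injectivity and linearity turn a basis of the kernel into a
  basis of the image with the same cardinality.\<close>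

lemma kernel_dim_eq_dim_image:
  fixes f :: "real Matrix.vec \<Rightarrow> 'b::real_vector"
  assumes A: "A \<in> carrier_mat nr nc"
    and inj: "inj_on f (carrier_vec nc)"
    and add: "\<And>u v. u \<in> carrier_vec nc \<Longrightarrow> v \<in> carrier_vec nc \<Longrightarrow> f (u + v) = f u + f v"
    and smult: "\<And>c v. v \<in> carrier_vec nc \<Longrightarrow> f (c \<cdot>\<^sub>v v) = c *\<^sub>R f v"
  shows "kernel_dim A = Real_Vector_Spaces.dim (f ` mat_kernel A)"
proof -
  interpret kernel nr nc A by unfold_locales (rule A)
  obtain B where B: "finite B" "basis B"
    using kernel_basis_exists[OF A] by blast
  have BK: "B \<subseteq> mat_kernel A" and indpt: "lin_indpt B" and gen: "span B = mat_kernel A"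
    using B(2) by (auto simp: Ker.basis_def)
  have BC: "B \<subseteq> carrier_vec nc"
    using BK mat_kernel_carrier[OF A] by blast
  have f0: "f (0\<^sub>v nc) = 0"
    using add[of "0\<^sub>v nc" "0\<^sub>v nc"] by simp
  have lc: "f (NC.lincomb a C) = (\<Sum>b\<in>C. a b *\<^sub>R f b)" if "finite C" "C \<subseteq> carrier_vec nc" for a C
    using that
  proof (induction C rule: finite_induct)
    case empty
    then show ?case by (simp add: NC.lincomb_def f0)
  next
    case (insert b C)
    then have "NC.lincomb a (insert b C) = a b \<cdot>\<^sub>v b + NC.lincomb a C"
      by (intro NC.lincomb_insert2) auto
    with insert show ?case by (simp add: add smult NC.lincomb_closed)
  qed
  have injB: "inj_on f B"
    using inj_on_subset[OF inj BC] .
  have "Real_Vector_Spaces.dim (f ` mat_kernel A) = card (f ` B)"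
  proof (rule real_vector.dim_unique[OF _ _ _ refl])
    show "f ` B \<subseteq> f ` mat_kernel A" using BK by blast
    show "f ` mat_kernel A \<subseteq> Real_Vector_Spaces.span (f ` B)"
    proof
      fix y assume "y \<in> f ` mat_kernel A"
      then obtain v where v: "v \<in> span B" "y = f v" using gen by blast
      obtain a where "lincomb a B = v"
        using Ker.finite_in_span[OF B(1) BK v(1)] by blast
      \<comment> \<open>\<open>lincomb\<close> lives in the kernel and \<open>NC.lincomb\<close> in
        the ambient coordinate space; \<open>lincomb_same\<close> identifies them on subsets of the
        kernel.\<close>
      then have "y = (\<Sum>b\<in>B. a b *\<^sub>R f b)"
        using lc[OF B(1) BC] lincomb_same[OF BK] v(2) by metis
      then show "y \<in> Real_Vector_Spaces.span (f ` B)"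
        by (simp add: real_vector.span_sum real_vector.span_scale real_vector.span_base)
    qed
    show "\<not> real_vector.dependent (f ` B)"
    proof (rule real_vector.independent_if_scalars_zero)
      show "finite (f ` B)" using B(1) by simp
      fix g y assume g: "(\<Sum>y\<in>f ` B. g y *\<^sub>R y) = 0" and "y \<in> f ` B"
      then obtain b where b: "b \<in> B" "y = f b" by blast
      have "f (NC.lincomb (g \<circ> f) B) = 0"
        using g lc[OF B(1) BC] by (simp add: sum.reindex[OF injB])
      then have "NC.lincomb (g \<circ> f) B = 0\<^sub>v nc"
        using inj_onD[OF inj, of "NC.lincomb (g \<circ> f) B" "0\<^sub>v nc"] f0 NC.lincomb_closed[OF BC] by simp
      then have "lincomb (g \<circ> f) B = 0\<^sub>v nc"
        using lincomb_same[OF BK] by simp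
      then show "g y = 0"
        using Ker.lin_dep_crit[OF B(1) subset_refl, of "g \<circ> f" b] indpt b by auto
    qed
  qed
  then show ?thesis
    using Ker.dim_basis[OF B] by (simp add: card_image[OF injB])
qed

section \<open>Arrays, tiles and the direction space\<close>

lemma entry_add [simp]: "entry (x + y) i j = entry x i j + entry y i j"
  and entry_diff [simp]: "entry (x - y) i j = entry x i j - entry y i j"
  and entry_scaleR [simp]: "entry (c *\<^sub>R x) i j = c * entry x i j"
  and entry_zero [simp]: "entry 0 i j = 0"
  by (simp_all add: entry_def)

lemma array_eqI:
  fixes x y :: "real ^ ('n::finite) tri"
  assumes "\<And>i j. (i, j) \<in> tri_index CARD('n) \<Longrightarrow> entry x i j = entry y i j"
  shows "x = y"
proof -
  have "x $ t = y $ t" for t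
    using assms[of "fst (tri_pair t)" "snd (tri_pair t)"] tri_pair[of t]
    by (simp add: entry_def tri_pair_inverse)
  then show ?thesis by (simp add: Finite_Cartesian_Product.vec_eq_iff)
qed

text \<open>The four displacements form two mutually inverse pairs, and indices are at least 1, so
  truncated subtraction does no harm.\<close>

lemma sym_tile_step: "sym (tile_step x)"
  by (rule symI) (auto simp: tile_step_def tri_index_def)

text \<open>The reflexive closure relates every pair of naturals to itself, hence
  \<open>UNIV\<close> here. Tiles are the classes of index pairs, and steps never leave the index
  set.\<close>

lemma equiv_tile_step_rtrancl: "equiv UNIV ((tile_step x)\<^sup>*)"
  by (intro equivI refl_rtrancl sym_rtrancl sym_tile_step trans_rtrancl) auto

lemma tile_step_rtrancl_tri_index:
  fixes x :: "real ^ ('n::finite) tri"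
  assumes "(p, q) \<in> (tile_step x)\<^sup>*" "p \<in> tri_index CARD('n)"
  shows "q \<in> tri_index CARD('n)"
  using assms by (induction rule: rtrancl_induct) (auto simp: tile_step_def)

lemma tile_subset_tri_index:
  fixes x :: "real ^ ('n::finite) tri"
  assumes "P \<in> tiling x"
  shows "P \<subseteq> tri_index CARD('n)"
  using assms by (auto simp: tiling_def quotient_def intro: tile_step_rtrancl_tri_index)

lemma tiling_subset_quotient: "tiling x \<subseteq> UNIV // (tile_step x)\<^sup>*"
  by (auto simp: tiling_def quotient_def)

lemma tile_nonempty: "P \<in> tiling x \<Longrightarrow> P \<noteq> {}"
  by (auto simp: tiling_def quotient_def)

lemma tile_eqI: "P \<in> tiling x \<Longrightarrow> Q \<in> tiling x \<Longrightarrow> p \<in> P \<Longrightarrow> p \<in> Q \<Longrightarrow> P = Q"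
  using quotient_disj[OF equiv_tile_step_rtrancl[of x], of P Q] tiling_subset_quotient[of x] by blast

lemma tile_step_mem_iff:
  assumes "P \<in> tiling x" "(p, q) \<in> tile_step x"
  shows "p \<in> P \<longleftrightarrow> q \<in> P"
  using assms in_quotient_imp_closed[OF equiv_tile_step_rtrancl[of x], of P] tiling_subset_quotient[of x]
    symD[OF sym_tile_step] by blast

lemma tile_connected: "P \<in> tiling x \<Longrightarrow> p \<in> P \<Longrightarrow> q \<in> P \<Longrightarrow> (p, q) \<in> (tile_step x)\<^sup>*"
  using in_quotient_imp_in_rel[OF equiv_tile_step_rtrancl[of x], of P p q] tiling_subset_quotient[of x]
  by blast

text \<open>The direction space of the minimal face through \<open>x\<close>.\<close>
definition tile_directions :: "real ^ ('n::finite) tri \<Rightarrow> (real ^ 'n tri) set" where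
  "tile_directions x = {w.
     (\<forall>((i, j), (i', j'))\<in>tile_step x. entry w i' j' = entry w i j) \<and>
     entry w 1 1 = 0 \<and> (\<forall>i\<in>{1..CARD('n)}. entry w i CARD('n) = 0) \<and>
     (\<forall>j\<in>{1..CARD('n)}. (\<Sum>i=1..j. entry w i j) = 0)}"

lemma subspace_tile_directions: "real_vector.subspace (tile_directions x)"
  unfolding real_vector.subspace_def tile_directions_def
  by (auto simp: sum.distrib simp flip: sum_distrib_left split: prod.splits)

text \<open>The definition constrains single steps only; induction along a path inside the tile
  extends this to any two of its positions.\<close>

lemma tile_directions_const:
  assumes "w \<in> tile_directions x" "P \<in> tiling x" "(i, j) \<in> P" "(i', j') \<in> P"
  shows "entry w i' j' = entry w i j"
proof -
  have "case_prod (entry w) q = case_prod (entry w) p" if "(p, q) \<in> (tile_step x)\<^sup>*" for p q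
    using that assms(1) by (induction rule: rtrancl_induct) (fastforce simp: tile_directions_def)+
  from this[OF tile_connected[OF assms(2-4)]] show ?thesis by simp
qed

section \<open>The kernel of the tiling matrix as a space of arrays\<close>

text \<open>A sum of indicators instead of a lookup: linearity in \<open>v\<close> is immediate, and
  positions outside the listed tiles get 0 by default.\<close>

definition tile_array :: "(nat \<times> nat) set list \<Rightarrow> real Matrix.vec \<Rightarrow> real ^ ('n::finite) tri" where
  "tile_array Ps v = (\<chi> t. \<Sum>k<length Ps. vec_index v k * of_bool (tri_pair t \<in> Ps ! k))"

lemma entry_tile_array:
  assumes "(i, j) \<in> tri_index CARD('n)"
  shows "entry (tile_array Ps v :: real ^ ('n::finite) tri) i j =
    (\<Sum>k<length Ps. vec_index v k * of_bool ((i, j) \<in> Ps ! k))"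
  using assms by (simp add: entry_def tile_array_def Tri_inverse)

lemma tile_array_add:
  assumes "u \<in> carrier_vec (length Ps)" "v \<in> carrier_vec (length Ps)"
  shows "tile_array Ps (u + v) = tile_array Ps u + tile_array Ps v"
  using assms
  by (simp add: tile_array_def Finite_Cartesian_Product.vec_eq_iff distrib_right sum.distrib)

lemma tile_array_smult:
  assumes "v \<in> carrier_vec (length Ps)"
  shows "tile_array Ps (c \<cdot>\<^sub>v v) = c *\<^sub>R tile_array Ps v"
  using assms
  by (simp add: tile_array_def Finite_Cartesian_Product.vec_eq_iff sum_distrib_left mult.assoc
      del: sum_mult_of_bool_eq)

context
  fixes x :: "real ^ ('n::finite) tri" and Ps :: "(nat \<times> nat) set list"
  assumes distinct: "distinct Ps" and free: "set Ps = free_tiles x"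
begin

lemma nth_tiling: "k < length Ps \<Longrightarrow> Ps ! k \<in> tiling x"
  using free nth_mem[of k Ps] by (auto simp: free_tiles_def)

lemma nth_unique: "k < length Ps \<Longrightarrow> l < length Ps \<Longrightarrow> p \<in> Ps ! k \<Longrightarrow> p \<in> Ps ! l \<Longrightarrow> k = l"
  using tile_eqI[OF nth_tiling nth_tiling] nth_eq_iff_index_eq[OF distinct] by blast

lemma entry_tile_array_nth:
  assumes "k < length Ps" "(i, j) \<in> Ps ! k"
  shows "entry (tile_array Ps v :: real ^ 'n tri) i j = vec_index v k"
proof -
  have "(i, j) \<in> tri_index CARD('n)"
    using tile_subset_tri_index[OF nth_tiling] assms by blast
  then have "entry (tile_array Ps v :: real ^ 'n tri) i j =
      (\<Sum>l<length Ps. vec_index v l * of_bool ((i, j) \<in> Ps ! l))"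
    by (rule entry_tile_array)
  also have "\<dots> = (\<Sum>l<length Ps. if l = k then vec_index v k else 0)"
  proof (rule sum.cong[OF refl])
    fix l assume "l \<in> {..<length Ps}"
    then have "(i, j) \<in> Ps ! l \<longleftrightarrow> l = k"
      using nth_unique[of l k "(i, j)"] assms by auto
    then show "vec_index v l * of_bool ((i, j) \<in> Ps ! l) = (if l = k then vec_index v k else 0)"
      by simp
  qed
  finally show ?thesis using assms(1) by simp
qed

lemma entry_tile_array_not_free:
  assumes "(i, j) \<in> tri_index CARD('n)" "\<And>P. P \<in> free_tiles x \<Longrightarrow> (i, j) \<notin> P"
  shows "entry (tile_array Ps v :: real ^ 'n tri) i j = 0"
proof -
  have "(i, j) \<notin> Ps ! k" if "k < length Ps" for k
    using assms(2) free nth_mem[OF that] by blast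
  with assms(1) show ?thesis
    by (simp add: entry_tile_array)
qed

lemma inj_tile_array: "inj_on (tile_array Ps :: _ \<Rightarrow> real ^ 'n tri) (carrier_vec (length Ps))"
proof (rule inj_onI)
  fix u v :: "real Matrix.vec"
  assume uv: "u \<in> carrier_vec (length Ps)" "v \<in> carrier_vec (length Ps)"
    and eq: "tile_array Ps u = (tile_array Ps v :: real ^ 'n tri)"
  have "vec_index u k = vec_index v k" if k: "k < length Ps" for k
  proof -
    obtain i j where "(i, j) \<in> Ps ! k"
      using tile_nonempty[OF nth_tiling[OF k]] by fast
    from entry_tile_array_nth[OF k this] eq show ?thesis by metis
  qed
  with uv show "u = v" by (intro eq_vecI) auto
qed

text \<open>Swapping the sums weights the value of each tile by its number of positions in row
  \<open>j\<close>. The matrix starts with row 2 at index 0, hence \<open>j - 2\<close>.\<close>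

lemma tile_array_row_sum:
  assumes j: "j \<in> {2..CARD('n) - 1}" and v: "v \<in> carrier_vec (length Ps)"
  shows "(\<Sum>i=1..j. entry (tile_array Ps v :: real ^ 'n tri) i j) =
    vec_index (tiling_matrix CARD('n) Ps *\<^sub>v v) (j - 2)"
proof -
  have col: "(\<Sum>i=1..j. of_bool ((i, j) \<in> Ps ! k)) = real (card {i. (i, j) \<in> Ps ! k})"
    if "k < length Ps" for k
  proof -
    have "{i. (i, j) \<in> Ps ! k} = {1..j} \<inter> {i. (i, j) \<in> Ps ! k}"
      using tile_subset_tri_index[OF nth_tiling[OF that]] by (auto simp: tri_index_def)
    then show ?thesis by (simp add: sum.If_cases of_bool_def)
  qed
  have "(\<Sum>i=1..j. entry (tile_array Ps v :: real ^ 'n tri) i j) =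
      (\<Sum>i=1..j. \<Sum>k<length Ps. vec_index v k * of_bool ((i, j) \<in> Ps ! k))"
    using j by (intro sum.cong refl entry_tile_array) (auto simp: tri_index_def)
  also have "\<dots> = (\<Sum>k<length Ps. vec_index v k * (\<Sum>i=1..j. of_bool ((i, j) \<in> Ps ! k)))"
    by (subst sum.swap) (simp only: sum_distrib_left)
  also have "\<dots> = (\<Sum>k<length Ps. vec_index v k * real (card {i. (i, j) \<in> Ps ! k}))"
    by (intro sum.cong refl) (simp only: col lessThan_iff)
  also have "\<dots> = vec_index (tiling_matrix CARD('n) Ps *\<^sub>v v) (j - 2)"
  proof -
    have "j - 2 < CARD('n) - 2" "Suc (Suc (j - 2)) = j" using j by auto
    then show ?thesis
      using v by (simp add: tiling_matrix_def mult_mat_vec_def scalar_prod_def lessThan_atLeast0 mult.commute)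
  qed
  finally show ?thesis .
qed

text \<open>Free tiles avoid (1,1) and the top row, and adjacent equal positions share their tile;
  so of the conditions defining \<open>tile_directions\<close> only the row sums are in
  question.\<close>

lemma tile_array_in_directions_iff:
  assumes v: "v \<in> carrier_vec (length Ps)"
  shows "(tile_array Ps v :: real ^ 'n tri) \<in> tile_directions x
    \<longleftrightarrow> v \<in> mat_kernel (tiling_matrix CARD('n) Ps)"
proof -
  let ?w = "tile_array Ps v :: real ^ 'n tri" and ?A = "tiling_matrix CARD('n) Ps"
  have top: "entry ?w i CARD('n) = 0" if "i \<in> {1..CARD('n)}" for i
    using that by (intro entry_tile_array_not_free) (auto simp: free_tiles_def tri_index_def)
  have bot: "entry ?w 1 1 = 0"
    by (intro entry_tile_array_not_free) (auto simp: free_tiles_def tri_index_def Suc_le_eq)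
  have step: "entry ?w i' j' = entry ?w i j" if "((i, j), (i', j')) \<in> tile_step x" for i j i' j'
  proof -
    have "(i, j) \<in> tri_index CARD('n)" "(i', j') \<in> tri_index CARD('n)"
      using that by (auto simp: tile_step_def)
    then show ?thesis
      using tile_step_mem_iff[OF nth_tiling that] by (simp add: entry_tile_array)
  qed
  \<comment> \<open>All entries in rows 1 and n are 0, which leaves exactly the rows of the matrix;
    for n at most 2 there are none.\<close>
  have outer: "(\<Sum>i=1..j. entry ?w i j) = 0" if "j = 1 \<or> j = CARD('n)" for j
    using that top bot by auto
  have "?w \<in> tile_directions x \<longleftrightarrow> (\<forall>j\<in>{1..CARD('n)}. (\<Sum>i=1..j. entry ?w i j) = 0)"
    using top bot step by (auto simp: tile_directions_def)
  also have "\<dots> \<longleftrightarrow> (\<forall>j\<in>{2..CARD('n) - 1}. (\<Sum>i=1..j. entry ?w i j) = 0)"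
  proof -
    have "j \<in> {2..CARD('n) - 1} \<or> j = 1 \<or> j = CARD('n)" if "j \<in> {1..CARD('n)}" for j
      using that by auto
    then show ?thesis using outer by fastforce
  qed
  also have "\<dots> \<longleftrightarrow> (\<forall>j\<in>{2..CARD('n) - 1}. vec_index (?A *\<^sub>v v) (j - 2) = 0)"
    using tile_array_row_sum[OF _ v] by simp
  also have "\<dots> \<longleftrightarrow> (\<forall>r<CARD('n) - 2. vec_index (?A *\<^sub>v v) r = 0)"
  proof -
    have "{..<CARD('n) - 2} = (\<lambda>j. j - 2) ` {2..CARD('n) - 1}"
      by (auto intro!: image_eqI[of _ _ "_ + 2"])
    then show ?thesis by (metis (no_types, lifting) image_iff lessThan_iff)
  qed
  also have "\<dots> \<longleftrightarrow> v \<in> mat_kernel ?A"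
    using v by (auto simp: mat_kernel_def tiling_matrix_def Matrix.vec_eq_iff)
  finally show ?thesis .
qed

text \<open>The value of \<open>w\<close> on each free tile serves as a coordinate; elsewhere both
  arrays vanish.\<close>

lemma directions_subset_tile_array:
  "tile_directions x \<subseteq> (tile_array Ps :: _ \<Rightarrow> real ^ 'n tri) ` carrier_vec (length Ps)"
proof
  fix w assume w: "w \<in> tile_directions x"
  \<comment> \<open>The chosen representative is immaterial, as \<open>w\<close> is constant on
    tiles.\<close>
  define v where "v = Matrix.vec (length Ps) (\<lambda>k. case_prod (entry w) (SOME p. p \<in> Ps ! k))"
  have v: "vec_index v k = entry w i j" if "k < length Ps" "(i, j) \<in> Ps ! k" for k i j
  proof -
    obtain a b where ab: "(SOME p. p \<in> Ps ! k) = (a, b)" by fastforce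
    have "(a, b) \<in> Ps ! k"
      using someI[of "\<lambda>p. p \<in> Ps ! k", OF that(2)] unfolding ab .
    from tile_directions_const[OF w nth_tiling[OF that(1)] that(2) this] that(1) show ?thesis
      by (simp add: v_def ab)
  qed
  have "w = tile_array Ps v"
  proof (rule array_eqI)
    fix i j assume ij: "(i, j) \<in> tri_index CARD('n)"
    show "entry w i j = entry (tile_array Ps v :: real ^ 'n tri) i j"
    proof (cases "\<exists>P\<in>free_tiles x. (i, j) \<in> P")
      case True
      then obtain k where k: "k < length Ps" "(i, j) \<in> Ps ! k"
        using free by (metis in_set_conv_nth)
      show ?thesis
        unfolding entry_tile_array_nth[OF k] v[OF k] ..
    next
      case False
      let ?P = "(tile_step x)\<^sup>* `` {(i, j)}"
      have P: "?P \<in> tiling x" "(i, j) \<in> ?P"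
        using ij by (auto simp: tiling_def intro: quotientI)
      \<comment> \<open>The tile of (i,j) is not free, so it contains (1,1) or a top-row position,
        where \<open>w\<close> is 0.\<close>
      then obtain a b where ab: "(a, b) \<in> ?P" "(a, b) = (1, 1) \<or> a \<in> {1..CARD('n)} \<and> b = CARD('n)"
        using False unfolding free_tiles_def by blast
      have "entry w i j = entry w a b"
        by (rule tile_directions_const[OF w P(1) ab(1) P(2)])
      also have "\<dots> = 0"
        using w ab(2) by (auto simp: tile_directions_def)
      also have "\<dots> = entry (tile_array Ps v :: real ^ 'n tri) i j"
        using False ij by (intro entry_tile_array_not_free[symmetric]) auto
      finally show ?thesis .
    qed
  qed
  moreover have "v \<in> carrier_vec (length Ps)"
    by (simp add: v_def)
  ultimately show "w \<in> tile_array Ps ` carrier_vec (length Ps)"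
    by (rule image_eqI)
qed

lemma tile_array_image_kernel:
  "(tile_array Ps :: _ \<Rightarrow> real ^ 'n tri) ` mat_kernel (tiling_matrix CARD('n) Ps) = tile_directions x"
proof -
  have "mat_kernel (tiling_matrix CARD('n) Ps) \<subseteq> carrier_vec (length Ps)"
    by (auto simp: mat_kernel_def tiling_matrix_def)
  then show ?thesis
    using tile_array_in_directions_iff directions_subset_tile_array by blast
qed

end

section \<open>The face cut out by the adjacencies inside the tiles\<close>

text \<open>Adjacent positions are linked by one of the interlacing inequalities. Its orientation
  depends on the positions alone, so the disjunction stands outside the quantifiers over
  \<open>z\<close>.\<close>

lemma tile_step_monotone:
  fixes x :: "real ^ ('n::finite) tri"
  assumes "((i, j), (i', j')) \<in> tile_step x"
  shows "(\<forall>z :: real ^ 'n tri. gt_pattern z \<longrightarrow> entry z i j \<le> entry z i' j') \<or>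
         (\<forall>z :: real ^ 'n tri. gt_pattern z \<longrightarrow> entry z i' j' \<le> entry z i j)"
proof -
  have bounds: "1 \<le> i" "i \<le> j" "j \<le> CARD('n)" "1 \<le> i'" "i' \<le> j'" "j' \<le> CARD('n)"
    using assms by (auto simp: tile_step_def tri_index_def)
  consider "i' = i + 1" "j' = j + 1" | "i' = i" "j' = j + 1"
    | "i = i' + 1" "j = j' + 1" | "i = i'" "j = j' + 1"
    using assms bounds unfolding tile_step_def by fastforce
  then show ?thesis
    by cases (use bounds in \<open>auto simp: gt_pattern_def\<close>)
qed

text \<open>By \<open>tile_step_monotone\<close> each difference along a step has a constant sign on
  the polytope. If it vanishes inside a segment, it is a positive combination of two numbers of the
  same sign, so it vanishes at both ends.\<close>

lemma face_of_tile_step_equal: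
  fixes x :: "real ^ ('n::finite) tri"
  shows "{z \<in> gt_polytope lam mu. \<forall>((i, j), (i', j'))\<in>tile_step x. entry z i' j' = entry z i j}
     face_of (gt_polytope lam mu :: (real ^ 'n tri) set)"
  (is "?G face_of ?S")
  unfolding face_of_def
proof (intro conjI ballI impI)
  show "?G \<subseteq> ?S" by blast
  have "?G = ?S \<inter> {z. \<forall>((i, j), (i', j'))\<in>tile_step x. entry z i' j' = entry z i j}" by blast
  moreover have "convex {z :: real ^ 'n tri. \<forall>((i, j), (i', j'))\<in>tile_step x. entry z i' j' = entry z i j}"
    by (rule convexI) (auto split: prod.splits)
  ultimately show "convex ?G"
    by (simp add: convex_Int convex_gt_polytope)
  fix a b y assume a: "a \<in> ?S" and b: "b \<in> ?S" and y: "y \<in> ?G" and seg: "y \<in> open_segment a b"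
  obtain u where u: "0 < u" "u < 1" "y = (1 - u) *\<^sub>R a + u *\<^sub>R b"
    using seg by (auto simp: in_segment)
  have "entry a i' j' = entry a i j \<and> entry b i' j' = entry b i j"
    if s: "((i, j), (i', j')) \<in> tile_step x" for i j i' j'
  proof -
    let ?d = "\<lambda>z. entry z i' j' - entry z i j"
    have "?d y = 0" using y s by force
    then have 0: "(1 - u) * ?d a + u * ?d b = 0"
      by (simp add: u(3) algebra_simps)
    have "gt_pattern a" "gt_pattern b" using a b by (auto simp: gt_polytope_def)
    with tile_step_monotone[OF s] have "?d a \<ge> 0 \<and> ?d b \<ge> 0 \<or> ?d a \<le> 0 \<and> ?d b \<le> 0"
      unfolding diff_ge_0_iff_ge diff_le_0_iff_le by blast
    then show ?thesis
    proof
      assume "?d a \<ge> 0 \<and> ?d b \<ge> 0"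
      then have "(1 - u) * ?d a \<ge> 0" "u * ?d b \<ge> 0" using u by auto
      with 0 have "(1 - u) * ?d a = 0" "u * ?d b = 0" by linarith+
      with u show ?thesis by auto
    next
      assume "?d a \<le> 0 \<and> ?d b \<le> 0"
      then have "(1 - u) * ?d a \<le> 0" "u * ?d b \<le> 0" using u by (auto simp: mult_le_0_iff)
      with 0 have "(1 - u) * ?d a = 0" "u * ?d b = 0" by linarith+
      with u show ?thesis by auto
    qed
  qed
  with a b show "a \<in> ?G" "b \<in> ?G" by auto
qed

text \<open>The weight conditions telescope: the sum of row \<open>j\<close> is
  \<open>mu 1 + ... + mu j\<close> for every point of the polytope.\<close>

lemma gt_polytope_row_sums:
  fixes y z :: "real ^ ('n::finite) tri"
  assumes "y \<in> gt_polytope lam mu" "z \<in> gt_polytope lam mu" "j \<in> {1..CARD('n)}"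
  shows "(\<Sum>i=1..j. entry y i j) = (\<Sum>i=1..j. entry z i j)"
  using assms(3)
proof (induction j)
  case (Suc j)
  show ?case
  proof (cases "j = 0")
    case True
    then show ?thesis using assms(1,2) by (simp add: gt_polytope_def)
  next
    case False
    then have j: "Suc j \<in> {2..CARD('n)}" "j \<in> {1..CARD('n)}" using Suc.prems by auto
    have r: "(\<Sum>i=1..Suc j. entry t i (Suc j)) = of_int (mu (Suc j)) + (\<Sum>i=1..j. entry t i j)"
      if "t \<in> gt_polytope lam mu" for t :: "real ^ 'n tri"
      using that j(1) unfolding gt_polytope_def by (auto dest!: bspec[of _ _ "Suc j"])
    show ?thesis
      unfolding r[OF assms(1)] r[OF assms(2)] using Suc.IH j(2) by simp
  qed
qed simp

text \<open>The face of \<open>face_of_tile_step_equal\<close> contains \<open>x\<close>, hence the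
  whole minimal face; the remaining conditions compare two points with the same boundary values and
  row sums.\<close>

lemma minimal_face_diff_in_directions:
  fixes x z :: "real ^ ('n::finite) tri"
  assumes x: "x \<in> gt_polytope lam mu" and z: "z \<in> minimal_face (gt_polytope lam mu) x"
  shows "z - x \<in> tile_directions x"
proof -
  let ?S = "gt_polytope lam mu :: (real ^ 'n tri) set"
  have "x \<in> {z \<in> ?S. \<forall>((i, j), (i', j'))\<in>tile_step x. entry z i' j' = entry z i j}"
    using x by (auto simp: tile_step_def)
  from minimal_face_least[OF convex_gt_polytope minimal_face_is_arg_min[OF convex_gt_polytope x]
      face_of_tile_step_equal this] z
  have zS: "z \<in> ?S" and zeq: "\<forall>((i, j), (i', j'))\<in>tile_step x. entry z i' j' = entry z i j"
    by blast+
  have "entry (z - x) i' j' = entry (z - x) i j" if "((i, j), (i', j')) \<in> tile_step x" for i j i' j'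
    using zeq that by (auto simp: tile_step_def)
  moreover have "entry (z - x) 1 1 = 0" "\<forall>i\<in>{1..CARD('n)}. entry (z - x) i CARD('n) = 0"
    using zS x by (simp_all add: gt_polytope_def)
  moreover have "\<forall>j\<in>{1..CARD('n)}. (\<Sum>i=1..j. entry (z - x) i j) = 0"
    using gt_polytope_row_sums[OF zS x] by (simp add: sum_subtractf)
  ultimately show ?thesis
    unfolding tile_directions_def by blast
qed

section \<open>Perturbing a point inside the polytope\<close>

text \<open>
  Zero entries propagate to the top row along \<open>(i, j), (i + 1, j + 1), \<dots>\<close>, so the constraint
  \<open>0 \<le> x\<^sub>i\<^sub>j\<close> is tight only on tiles that are not free.
\<close>
lemma tile_directions_zero:
  fixes x w :: "real ^ ('n::finite) tri"
  assumes x: "gt_pattern x" and w: "w \<in> tile_directions x"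
    and ij: "1 \<le> i" "i \<le> j" "j \<le> CARD('n)" and 0: "entry x i j = 0"
  shows "entry w i j = 0"
  using ij(3,1,2) 0
proof (induction j arbitrary: i rule: inc_induct)
  case base
  then show ?case using w by (simp add: tile_directions_def)
next
  case (step j)
  have le: "entry x (i + 1) (j + 1) \<le> entry x i j" and ge: "0 \<le> entry x (i + 1) (j + 1)"
    using x[unfolded gt_pattern_def, THEN conjunct2, rule_format, of i j]
      x[unfolded gt_pattern_def, THEN conjunct1, rule_format, of "i + 1" "j + 1"]
      step.hyps step.prems(1,2) by simp_all
  with step.prems have x0: "entry x (i + 1) (j + 1) = 0" by linarith
  then have "((i, j), (i + 1, j + 1)) \<in> tile_step x"
    using step.hyps step.prems by (auto simp: tile_step_def tri_index_def)
  then have "entry w (i + 1) (j + 1) = entry w i j"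
    using w by (fastforce simp: tile_directions_def)
  moreover have "entry w (i + 1) (j + 1) = 0"
    using step.IH[of "i + 1"] step.prems x0 by simp
  ultimately show ?case by simp
qed

text \<open>A slack inequality survives by continuity, a tight one because it does not change. The
  two-sided filter \<open>nhds 0\<close> covers both signs of \<open>e\<close>.\<close>

lemma eventually_affine_nonneg:
  fixes a b :: real
  assumes "0 \<le> a" "a = 0 \<Longrightarrow> b = 0"
  shows "eventually (\<lambda>e. 0 \<le> a + e * b) (nhds 0)"
proof (cases "a = 0")
  case False
  have "((\<lambda>e. a + e * b) \<longlongrightarrow> a + 0 * b) (nhds 0)"
    by (intro tendsto_intros tendsto_ident_at filterlim_ident)
  then have "eventually (\<lambda>e. 0 < a + e * b) (nhds 0)"
    using False assms(1) by (intro order_tendstoD(1)) auto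
  then show ?thesis by eventually_elim simp
qed (use assms in simp)

text \<open>Finitely many inequalities are involved. A tight interlacing inequality is a tile step,
  along which \<open>w\<close> agrees; a tight sign condition is handled by
  \<open>tile_directions_zero\<close>. The equations hold for every \<open>e\<close>.\<close>

lemma eventually_perturb_in_gt_polytope:
  fixes x w :: "real ^ ('n::finite) tri"
  assumes x: "x \<in> gt_polytope lam mu" and w: "w \<in> tile_directions x"
  shows "eventually (\<lambda>e. x + e *\<^sub>R w \<in> gt_polytope lam mu) (nhds 0)"
proof -
  let ?n = "CARD('n)"
  have gx: "gt_pattern x" using x by (simp add: gt_polytope_def)
  have wstep: "entry w i' j' = entry w i j" if "((i, j), (i', j')) \<in> tile_step x" for i j i' j'
    using w that by (fastforce simp: tile_directions_def)
  have nonneg: "eventually (\<lambda>e. \<forall>(i, j)\<in>tri_index ?n. 0 \<le> entry x i j + e * entry w i j) (nhds 0)"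
  proof (intro eventually_ball_finite finite_tri_index ballI, clarify)
    fix i j assume "(i, j) \<in> tri_index ?n"
    then show "eventually (\<lambda>e. 0 \<le> entry x i j + e * entry w i j) (nhds 0)"
      using gx tile_directions_zero[OF gx w, of i j]
      by (intro eventually_affine_nonneg) (auto simp: gt_pattern_def tri_index_def)
  qed
  have inner: "1 \<le> i" "i \<le> j" "j + 1 \<le> ?n" if "(i, j) \<in> tri_index (?n - 1)" for i j
    using that by (auto simp: tri_index_def)
  \<comment> \<open>\<open>tri_index (?n - 1)\<close> consists of the positions below the top row,
    those with two upper neighbours.\<close>
  have up: "eventually (\<lambda>e. \<forall>(i, j)\<in>tri_index (?n - 1).
      0 \<le> (entry x i (j + 1) - entry x i j) + e * (entry w i (j + 1) - entry w i j)) (nhds 0)"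
  proof (intro eventually_ball_finite finite_tri_index ballI, clarify)
    fix i j assume ij: "(i, j) \<in> tri_index (?n - 1)"
    show "eventually (\<lambda>e. 0 \<le> (entry x i (j + 1) - entry x i j) + e * (entry w i (j + 1) - entry w i j)) (nhds 0)"
      using gx inner[OF ij] wstep[of i j i "j + 1"]
      by (intro eventually_affine_nonneg) (auto simp: gt_pattern_def tri_index_def tile_step_def)
  qed
  have down: "eventually (\<lambda>e. \<forall>(i, j)\<in>tri_index (?n - 1).
      0 \<le> (entry x i j - entry x (i + 1) (j + 1)) + e * (entry w i j - entry w (i + 1) (j + 1))) (nhds 0)"
  proof (intro eventually_ball_finite finite_tri_index ballI, clarify)
    fix i j assume ij: "(i, j) \<in> tri_index (?n - 1)"
    show "eventually (\<lambda>e. 0 \<le> (entry x i j - entry x (i + 1) (j + 1)) + e * (entry w i j - entry w (i + 1) (j + 1))) (nhds 0)"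
      using gx inner[OF ij] wstep[of i j "i + 1" "j + 1"]
      by (intro eventually_affine_nonneg) (auto simp: gt_pattern_def tri_index_def tile_step_def)
  qed
  have row: "(\<Sum>i=1..j. entry (x + e *\<^sub>R w) i j) = (\<Sum>i=1..j. entry x i j)" if "j \<in> {1..?n}" for e j
    using w that by (simp add: sum.distrib tile_directions_def flip: sum_distrib_left)
  from nonneg up down show ?thesis
  proof eventually_elim
    case (elim e)
    have "gt_pattern (x + e *\<^sub>R w)"
      unfolding gt_pattern_def
    proof (intro conjI allI impI)
      fix i j assume "1 \<le> i \<and> i \<le> j \<and> j \<le> ?n"
      then show "0 \<le> entry (x + e *\<^sub>R w) i j"
        using elim(1) by (auto simp: tri_index_def)
    next
      fix i j assume "1 \<le> i \<and> i \<le> j \<and> j + 1 \<le> ?n"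
      then have ij: "(i, j) \<in> tri_index (?n - 1)" by (auto simp: tri_index_def)
      show "entry (x + e *\<^sub>R w) i j \<le> entry (x + e *\<^sub>R w) i (j + 1)"
        using bspec[OF elim(2) ij] by (simp add: algebra_simps)
      show "entry (x + e *\<^sub>R w) (i + 1) (j + 1) \<le> entry (x + e *\<^sub>R w) i j"
        using bspec[OF elim(3) ij] by (simp add: algebra_simps)
    qed
    moreover have "(\<Sum>i=1..j. entry (x + e *\<^sub>R w) i j) - (\<Sum>i=1..j - 1. entry (x + e *\<^sub>R w) i (j - 1)) = of_int (mu j)"
      if "j \<in> {2..?n}" for j
    proof -
      have "j \<in> {1..?n}" "j - 1 \<in> {1..?n}" using that by auto
      from row[OF this(1)] row[OF this(2)] show ?thesis
        using x that unfolding gt_polytope_def by auto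
    qed
    ultimately show ?case
      using x w by (auto simp: gt_polytope_def tile_directions_def)
  qed
qed

text \<open>A face through the midpoint of a nondegenerate segment in the polytope contains its
  endpoints; the segment runs from \<open>x + e w\<close> to \<open>x - e w\<close>.\<close>

lemma directions_perturb_in_minimal_face:
  fixes x w :: "real ^ ('n::finite) tri"
  assumes x: "x \<in> gt_polytope lam mu" and w: "w \<in> tile_directions x"
  obtains e where "0 < e" "x + e *\<^sub>R w \<in> minimal_face (gt_polytope lam mu) x"
proof (cases "w = 0")
  case True
  then show ?thesis
    using that[of 1] minimal_face_is_arg_min[OF convex_gt_polytope x] by (simp add: is_arg_min_def)
next
  case False
  obtain d where d: "d > 0" "\<And>e. dist e 0 < d \<Longrightarrow> x + e *\<^sub>R w \<in> gt_polytope lam mu"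
    using eventually_perturb_in_gt_polytope[OF x w] by (auto simp: eventually_nhds_metric)
  define e where "e = d / 2"
  have e: "e > 0" "x + e *\<^sub>R w \<in> gt_polytope lam mu" "x + (- e) *\<^sub>R w \<in> gt_polytope lam mu"
    using d(1) d(2)[of e] d(2)[of "- e"] by (simp_all add: e_def)
  have "x = midpoint (x + e *\<^sub>R w) (x + (- e) *\<^sub>R w)"
    by (simp add: midpoint_def scaleR_2[symmetric])
  \<comment> \<open>An open segment with equal endpoints is empty, hence the separate case
    \<open>w = 0\<close>.\<close>
  moreover have "x + e *\<^sub>R w \<noteq> x + (- e) *\<^sub>R w"
    using False e(1) by (simp add: eq_neg_iff_add_eq_0 flip: scaleR_2)
  ultimately have "x \<in> open_segment (x + e *\<^sub>R w) (x + (- e) *\<^sub>R w)"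
    by (metis midpoint_in_open_segment)
  moreover have "minimal_face (gt_polytope lam mu) x face_of gt_polytope lam mu"
      "x \<in> minimal_face (gt_polytope lam mu) x"
    using minimal_face_is_arg_min[OF convex_gt_polytope x] by (auto simp: is_arg_min_def)
  ultimately have "x + e *\<^sub>R w \<in> minimal_face (gt_polytope lam mu) x"
    using e(2,3) by (meson face_ofD)
  with e(1) that show ?thesis by blast
qed

section \<open>Dimension of the minimal face\<close>

lemma aff_dim_minimal_face:
  fixes x :: "real ^ ('n::finite) tri"
  assumes x: "x \<in> gt_polytope lam mu"
  shows "aff_dim (minimal_face (gt_polytope lam mu) x) = int (Real_Vector_Spaces.dim (tile_directions x))"
proof -
  let ?F = "minimal_face (gt_polytope lam mu) x"
  have "x \<in> ?F"
    using minimal_face_is_arg_min[OF convex_gt_polytope x] by (auto simp: is_arg_min_def)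
  then have "aff_dim ?F = int (Real_Vector_Spaces.dim ((\<lambda>z. z - x) ` ?F))"
    by (intro aff_dim_eq_dim_subtract hull_inc)
  moreover have "Real_Vector_Spaces.span ((\<lambda>z. z - x) ` ?F) = tile_directions x"
  proof
    show "Real_Vector_Spaces.span ((\<lambda>z. z - x) ` ?F) \<subseteq> tile_directions x"
      using minimal_face_diff_in_directions[OF x]
      by (intro real_vector.span_minimal subspace_tile_directions) blast
    show "tile_directions x \<subseteq> Real_Vector_Spaces.span ((\<lambda>z. z - x) ` ?F)"
    proof
      fix w assume "w \<in> tile_directions x"
      then obtain e where e: "0 < e" "x + e *\<^sub>R w \<in> ?F"
        using directions_perturb_in_minimal_face[OF x] by blast
      then have "e *\<^sub>R w \<in> (\<lambda>z. z - x) ` ?F"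
        by (intro image_eqI[of _ _ "x + e *\<^sub>R w"]) auto
      \<comment> \<open>Only a small multiple of \<open>w\<close> is known to be a difference of
        points of the face; the span absorbs the factor.\<close>
      then have "(1 / e) *\<^sub>R (e *\<^sub>R w) \<in> Real_Vector_Spaces.span ((\<lambda>z. z - x) ` ?F)"
        by (intro real_vector.span_scale real_vector.span_base)
      with e(1) show "w \<in> Real_Vector_Spaces.span ((\<lambda>z. z - x) ` ?F)" by simp
    qed
  qed
  ultimately show ?thesis
    by (metis real_vector.dim_span)
qed

theorem theorem1p5:
  fixes lam mu :: "nat \<Rightarrow> int"
    and x :: "real ^ ('n::finite) tri"
    and Ps :: "(nat \<times> nat) set list"
  assumes "x \<in> gt_polytope lam mu"
    and "distinct Ps" and "set Ps = free_tiles x"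
  shows "int (kernel_dim (tiling_matrix CARD('n) Ps)) = aff_dim (minimal_face (gt_polytope lam mu) x)"
proof -
  have A: "tiling_matrix CARD('n) Ps \<in> carrier_mat (CARD('n) - 2) (length Ps)"
    by (simp add: tiling_matrix_def)
  have "kernel_dim (tiling_matrix CARD('n) Ps) = Real_Vector_Spaces.dim
      ((tile_array Ps :: _ \<Rightarrow> real ^ 'n tri) ` mat_kernel (tiling_matrix CARD('n) Ps))"
    by (rule kernel_dim_eq_dim_image[OF A inj_tile_array[OF assms(2,3)]])
      (simp_all add: tile_array_add tile_array_smult)
  also have "\<dots> = Real_Vector_Spaces.dim (tile_directions x)"
    by (simp add: tile_array_image_kernel[OF assms(2,3)])
  finally show ?thesis
    using aff_dim_minimal_face[OF assms(1)] by simp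
qed

end
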